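(* Let $(a_n)_{n\ge1}$ be the Hofstadter consecutive-sum sequence and put $b_n:=a_n-n$ for $n\ge1$. Then the sequence $(b_n)_{n\ge1}$ is nondecreasing and unbounded. Consequently, $a_n=n+\omega(1)$, i.e. $a_n-n\to\infty$ as $n\to\infty$, and the set $\{a_n:n\ge1\}$ omits infinitely many positive integers.
   Context: The Hofstadter consecutive-sum sequence $(a_n)_{n\ge1}$ is the strictly increasing integer sequence defined by $a_1=1$, $a_2=2$, and, for $k\ge3$, by taking $a_k$ to be the least integer greater than $a_{k-1}$ that can be written as $\sum_{i=p}^{q}a_i$ for some integers $1\le p<q\le k-1$ (a sum of at least two consecutive earlier terms). *)

theory Defs
  imports Complex_Main
begin

text \<open>
  The bound \<open>q \<le> k - 1\<close> has to be available when the recursive calls inside the sum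
  are shown to terminate.
\<close>

context
  notes conj_cong [fundef_cong]
begin

text \<open>
  The sequence is indexed from 1; the value at 0 is a dummy and enters neither the
  recursion nor the theorem.
\<close>

function hofstadter :: "nat \<Rightarrow> nat" where
  "hofstadter k =
    (if k = 0 then 0
     else if k = 1 then 1
     else if k = 2 then 2
     else (LEAST m. hofstadter (k - 1) < m \<and>
             (\<exists>p q. 1 \<le> p \<and> p < q \<and> q \<le> k - 1 \<and> m = (\<Sum>i = p..q. hofstadter i))))"
  by auto
termination
  by (relation "Wellfounded.measure id") auto

end

declare hofstadter.simps [simp del]

definition hofstadter_excess :: "nat \<Rightarrow> int" where
  "hofstadter_excess n = int (hofstadter n) - int n"

definition consecutive_sums :: "nat \<Rightarrow> nat set" where
  "consecutive_sums k =
    {m. \<exists>p q. 1 \<le> p \<and> p < q \<and> q \<le> k - 1 \<and> m = (\<Sum>i = p..q. hofstadter i)}"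

lemma hofstadter_1: "hofstadter 1 = 1"
  by (subst hofstadter.simps) simp

lemma hofstadter_2: "hofstadter 2 = 2"
  by (subst hofstadter.simps) simp

lemma hofstadter_rec:
  assumes "k \<ge> 3"
  shows "hofstadter k = (LEAST m. hofstadter (k - 1) < m \<and> m \<in> consecutive_sums k)"
  using assms by (subst hofstadter.simps) (simp add: consecutive_sums_def)

text \<open>The minimum in the recursion is always attained, so \<open>LEAST\<close> is meaningful.\<close>

lemma hofstadter_pos: "k \<ge> 1 \<Longrightarrow> hofstadter k \<ge> 1"
  and hofstadter_least_witness:
    "k \<ge> 3 \<Longrightarrow> \<exists>m. hofstadter (k - 1) < m \<and> m \<in> consecutive_sums k"
proof -
  have wit: "hofstadter (k - 1) < hofstadter (k - 2) + hofstadter (k - 1) \<and>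
      hofstadter (k - 2) + hofstadter (k - 1) \<in> consecutive_sums k"
    if k: "k \<ge> 3" and pos: "hofstadter (k - 2) \<ge> 1" for k
  proof -
    have eq: "{k - 2..k - 1} = {k - 2, k - 1}"
      using k by auto
    have "(\<Sum>i = k - 2..k - 1. hofstadter i) = hofstadter (k - 2) + hofstadter (k - 1)"
      unfolding eq using k by simp
    moreover have "1 \<le> k - 2" "k - 2 < k - 1"
      using k by auto
    ultimately have "hofstadter (k - 2) + hofstadter (k - 1) \<in> consecutive_sums k"
      unfolding consecutive_sums_def by (metis (mono_tags, lifting) mem_Collect_eq order_refl)
    then show ?thesis
      using pos by simp
  qed
  have pos: "hofstadter k \<ge> 1" if "k \<ge> 1" for k
    using that
  proof (induction k rule: less_induct)
    case (less k)
    consider "k = 1" | "k = 2" | "k \<ge> 3"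
      using less.prems by linarith
    then show ?case
    proof cases
      case 3
      have "hofstadter (k - 2) \<ge> 1"
        using less.IH 3 by simp
      from LeastI[of "\<lambda>m. hofstadter (k - 1) < m \<and> m \<in> consecutive_sums k", OF wit[OF 3 this]]
      show ?thesis
        using hofstadter_rec[OF 3] by simp
    qed (use hofstadter_1 hofstadter_2 in simp_all)
  qed
  show "k \<ge> 1 \<Longrightarrow> hofstadter k \<ge> 1"
    by (rule pos)
  show "\<exists>m. hofstadter (k - 1) < m \<and> m \<in> consecutive_sums k" if "k \<ge> 3"
  proof -
    have "1 \<le> k - 2"
      using that by simp
    from wit[OF that pos[OF this]] show ?thesis
      by blast
  qed
qed

lemma hofstadter_step:
  assumes "k \<ge> 3"
  shows "hofstadter (k - 1) < hofstadter k" and "hofstadter k \<in> consecutive_sums k"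
    and "\<And>m. hofstadter (k - 1) < m \<Longrightarrow> m \<in> consecutive_sums k \<Longrightarrow> hofstadter k \<le> m"
  using LeastI_ex[OF hofstadter_least_witness[OF assms]]
  by (auto simp: hofstadter_rec[OF assms] intro: Least_le)

lemma hofstadter_strict_mono: "strict_mono_on {1..} hofstadter"
proof -
  have "hofstadter n < hofstadter (Suc n)" if "n \<ge> 1" for n
  proof (cases "n = 1")
    case True
    then show ?thesis
      using hofstadter_1 hofstadter_2 by (simp add: numeral_2_eq_2)
  next
    case False
    then show ?thesis
      using hofstadter_step(1)[of "Suc n"] that by simp
  qed
  then have "hofstadter m < hofstadter n" if "m < n" "m \<ge> 1" for m n
    using that by (induction n) (auto simp: less_Suc_eq intro: less_trans)
  then show ?thesis
    by (auto intro!: strict_mono_onI)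
qed

end

theory Submission
  imports Defs
begin

text \<open>
  If the excess were bounded, it would eventually be a constant \<open>c\<close>, say from index \<open>N\<close> on, so all
  large integers, in particular all large numbers \<open>2 \<cdot> 4 ^ t\<close>, would be sums of at least two
  consecutive terms. Sums starting at an index \<open>p \<ge> N\<close> are sums of consecutive positive
  integers and hence never powers of two. Sums starting at \<open>p < N\<close> give
  \<open>(2 ^ (t + 2))\<^sup>2 = (2 q + 2 c + 1)\<^sup>2 + R p\<close>, where \<open>R p\<close> takes only finitely many values; as the
  two squares have different parity, they differ by at least \<open>2 ^ (t + 2)\<close>, which is impossible for
  large \<open>t\<close>.
\<close>

lemma hofstadter_Suc_gt: "n \<ge> 1 \<Longrightarrow> hofstadter n < hofstadter (Suc n)"
  using strict_mono_onD[OF hofstadter_strict_mono, of n "Suc n"] by simp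

lemma mono_on_hofstadter_excess: "mono_on {1..} hofstadter_excess"
proof (rule mono_onI)
  fix m n :: nat
  assume "m \<in> {1..}" "n \<in> {1..}" "m \<le> n"
  from \<open>m \<le> n\<close> \<open>m \<in> {1..}\<close> show "hofstadter_excess m \<le> hofstadter_excess n"
  proof (induction n rule: dec_induct)
    case (step n)
    then show ?case
      using hofstadter_Suc_gt[of n] by (simp add: hofstadter_excess_def)
  qed simp
qed

lemma hofstadter_excess_nonneg:
  assumes "n \<ge> 1"
  shows "hofstadter_excess n \<ge> 0"
proof -
  have "hofstadter_excess 1 \<le> hofstadter_excess n"
    using assms by (intro mono_onD[OF mono_on_hofstadter_excess]) auto
  then show ?thesis
    using hofstadter_1 by (simp add: hofstadter_excess_def)
qed

lemma sum_shifted_consecutive: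
  fixes c :: nat
  assumes "p \<le> Suc q"
  shows "8 * (\<Sum>i = p..q. int i + int c) =
    (2 * int q + 2 * int c + 1)\<^sup>2 - (2 * int p + 2 * int c - 1)\<^sup>2"
  using assms
proof (induction q)
  case 0
  then have "p = 0 \<or> p = 1"
    by auto
  then show ?case
    by (auto simp: power2_eq_square algebra_simps)
next
  case (Suc q)
  show ?case
  proof (cases "p \<le> Suc q")
    case True
    then show ?thesis
      using Suc.IH by (simp add: power2_eq_square algebra_simps)
  next
    case False
    then have "p = Suc (Suc q)"
      using Suc.prems by simp
    then show ?thesis
      by (simp add: power2_eq_square algebra_simps)
  qed
qed

lemma odd_dvd_power_two:
  fixes d :: nat
  assumes "odd d" "d dvd 2 ^ k"
  shows "d = 1"
proof -
  have "coprime d (2 ^ k)"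
    using assms(1) by simp
  then show ?thesis
    using assms(2) coprime_absorb_left[of d "2 ^ k"] by simp
qed

text \<open>Twice the sum is \<open>d * e\<close>, the number of terms times the sum of the first
  and last term. Since \<open>d + e\<close> is odd, one factor is an odd divisor of a power of two,
  hence 1, yet both factors exceed 1.\<close>

lemma sum_consecutive_neq_power_two:
  fixes c p q k :: nat
  assumes "1 \<le> p" "p < q"
  shows "(\<Sum>i = p..q. i + c) \<noteq> 2 ^ k"
proof
  assume eq: "(\<Sum>i = p..q. i + c) = 2 ^ k"
  define d where "d = q - p + 1"
  define e where "e = q + p + 2 * c"
  have "8 * int (2 ^ k) = (2 * int q + 2 * int c + 1)\<^sup>2 - (2 * int p + 2 * int c - 1)\<^sup>2"
    unfolding eq[symmetric] using sum_shifted_consecutive[of p q c] assms by simp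
  also have "\<dots> = 4 * (int d * int e)"
    using assms by (simp add: d_def e_def of_nat_diff power2_eq_square algebra_simps)
  finally have "int (d * e) = int (2 ^ Suc k)"
    by simp
  then have prod: "d * e = 2 ^ Suc k"
    by (simp only: of_nat_eq_iff)
  have "odd d \<or> odd e"
    using assms by (auto simp: d_def e_def)
  moreover have "d dvd 2 ^ Suc k" "e dvd 2 ^ Suc k"
    by (metis dvd_triv_left prod, metis dvd_triv_right prod)
  ultimately have "d = 1 \<or> e = 1"
    using odd_dvd_power_two by blast
  then show False
    using assms by (auto simp: d_def e_def)
qed

lemma odd_even_square_diff:
  fixes x y :: int
  assumes "odd x" "even y" "x \<ge> 0" "y \<ge> 0"
  shows "y \<le> \<bar>y\<^sup>2 - x\<^sup>2\<bar>"
proof -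
  have "1 \<le> \<bar>y - x\<bar>"
    using assms(1,2) by (cases "y = x") auto
  then have "1 * (y + x) \<le> \<bar>y - x\<bar> * (y + x)"
    using assms by (intro mult_right_mono) auto
  also have "\<dots> = \<bar>y\<^sup>2 - x\<^sup>2\<bar>"
    using assms by (simp add: power2_eq_square square_diff_square_factored abs_mult mult.commute)
  finally show ?thesis
    using assms by simp
qed

lemma hofstadter_not_eventually_shift:
  fixes N c :: nat
  assumes "N \<ge> 3" and shift: "\<And>n. n \<ge> N \<Longrightarrow> hofstadter n = n + c"
  shows False
proof -
  define A where "A = (\<Sum>i = 1..<N. hofstadter i)"
  \<comment> \<open>A bound, independent of \<open>p\<close>, for the difference of squares arising
    when the sum starts below \<open>N\<close>.\<close>
  define B where "B = 8 * int A + (2 * int N + 2 * int c - 1)\<^sup>2"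
  define t where "t = nat B + N + c"
  \<comment> \<open>The exponent is odd so that \<open>8 * m\<close> is the square of
    \<open>2 ^ (t + 2)\<close>; the summands \<open>N + c\<close> in \<open>t\<close> ensure
    \<open>m - c \<ge> N\<close>, so that \<open>m\<close> is itself a term.\<close>
  define m :: nat where "m = 2 ^ (2 * t + 1)"
  have "t < 2 ^ t"
    by simp
  also have "(2::nat) ^ t \<le> m"
    unfolding m_def by (intro power_increasing) auto
  finally have "t < m" .
  have "m - c \<ge> N" "m = hofstadter (m - c)"
    using \<open>t < m\<close> shift[of "m - c"] by (auto simp: t_def)
  then have "m \<in> consecutive_sums (m - c)"
    using hofstadter_step(2)[of "m - c"] \<open>N \<ge> 3\<close> by simp
  then obtain p q where pq: "1 \<le> p" "p < q" and m: "m = (\<Sum>i = p..q. hofstadter i)"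
    by (auto simp: consecutive_sums_def)
  have "B \<ge> 8 * int A"
    by (simp add: B_def)
  consider "N \<le> p" | "q < N" | "p < N" "N \<le> q"
    by linarith
  then show False
  proof cases
    case 1
    then have "m = (\<Sum>i = p..q. i + c)"
      unfolding m by (intro sum.cong) (auto simp: shift)
    then show False
      using sum_consecutive_neq_power_two[OF pq, of c "2 * t + 1"] by (simp add: m_def)
  next
    case 2
    then have "m \<le> A"
      unfolding m A_def using pq by (intro sum_mono2) auto
    then show False
      using \<open>t < m\<close> \<open>B \<ge> 8 * int A\<close> by (simp add: t_def)
  next
    case 3
    \<comment> \<open>Only the terms below index \<open>N\<close> are irregular; they contribute at
      most \<open>A\<close>, whatever \<open>p\<close> is.\<close>
    define P where "P = (\<Sum>i = p..<N. hofstadter i)"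
    have "P \<le> A"
      unfolding P_def A_def using pq by (intro sum_mono2) auto
    have "{p..q} = {p..<N} \<union> {N..q}"
      using 3 by auto
    then have "m = P + (\<Sum>i = N..q. hofstadter i)"
      unfolding m P_def by (simp add: sum.union_disjoint ivl_disj_int)
    also have "(\<Sum>i = N..q. hofstadter i) = (\<Sum>i = N..q. i + c)"
      by (intro sum.cong) (auto simp: shift)
    finally have "8 * int m = 8 * int P + 8 * (\<Sum>i = N..q. int i + int c)"
      by simp
    also have "\<dots> = 8 * int P + (2 * int q + 2 * int c + 1)\<^sup>2 - (2 * int N + 2 * int c - 1)\<^sup>2"
      using sum_shifted_consecutive[of N q c] 3 by simp
    also have "8 * int m = (2 ^ (t + 2))\<^sup>2"
      by (simp add: m_def power_mult power2_eq_square power_mult_distrib flip: power_add mult_2)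
    finally have diff: "(2 ^ (t + 2))\<^sup>2 - (2 * int q + 2 * int c + 1)\<^sup>2 =
        8 * int P - (2 * int N + 2 * int c - 1)\<^sup>2"
      by simp
    have "(2::int) ^ (t + 2) \<le> \<bar>8 * int P - (2 * int N + 2 * int c - 1)\<^sup>2\<bar>"
      unfolding diff[symmetric] by (intro odd_even_square_diff) auto
    also have "\<dots> \<le> B"
      \<comment> \<open>Both \<open>8 * P\<close> and the subtracted square are nonnegative, so
        their difference is at most their sum in absolute value.\<close>
      using \<open>P \<le> A\<close> unfolding B_def abs_le_iff
      using zero_le_power2[of "2 * int N + 2 * int c - 1"] by linarith
    also have "B \<le> int t"
      by (simp add: t_def)
    also have "int t < 2 ^ t"
      using of_nat_less_two_power by blast
    also have "(2::int) ^ t \<le> 2 ^ (t + 2)"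
      by (intro power_increasing) auto
    finally show False
      by simp
  qed
qed

text \<open>A bounded excess takes finitely many values, being a nonnegative integer. Its maximum is
  attained at some \<open>n0\<close>, and monotonicity keeps it there from \<open>n0\<close>
  on.\<close>

lemma hofstadter_excess_unbounded: "\<not> bdd_above (hofstadter_excess ` {1..})"
proof
  let ?E = "hofstadter_excess ` {1..}"
  assume "bdd_above ?E"
  then obtain b where "\<And>n. n \<ge> 1 \<Longrightarrow> hofstadter_excess n \<le> b"
    by (auto simp: bdd_above_def)
  then have "?E \<subseteq> {0..b}"
    using hofstadter_excess_nonneg by auto
  then have fin: "finite ?E"
    using finite_subset by blast
  then have "Max ?E \<in> ?E"
    by (intro Max_in) auto
  then obtain n0 where n0: "n0 \<ge> 1" "Max ?E = hofstadter_excess n0"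
    by auto
  define c where "c = nat (Max ?E)"
  have "hofstadter n = n + c" if "n \<ge> max 3 n0" for n
  proof -
    have "Max ?E \<le> hofstadter_excess n"
      unfolding n0(2) using n0(1) that
      by (intro mono_onD[OF mono_on_hofstadter_excess]) auto
    moreover have "hofstadter_excess n \<le> Max ?E"
      using fin that by (intro Max_ge) auto
    ultimately show ?thesis
      using hofstadter_excess_nonneg[of n] that by (auto simp: c_def hofstadter_excess_def)
  qed
  then show False
    using hofstadter_not_eventually_shift[of "max 3 n0" c] by simp
qed

lemma filterlim_hofstadter_excess: "filterlim hofstadter_excess at_top sequentially"
  unfolding filterlim_at_top
proof
  fix Z :: int
  obtain n0 where n0: "n0 \<ge> 1" "Z < hofstadter_excess n0"
    using hofstadter_excess_unbounded by (auto simp: bdd_above_def not_le)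
  have "Z \<le> hofstadter_excess n" if "n \<ge> n0" for n
    using mono_onD[OF mono_on_hofstadter_excess, of n0 n] n0 that by simp
  then show "\<forall>\<^sub>F n in sequentially. Z \<le> hofstadter_excess n"
    by (rule eventually_sequentiallyI)
qed

text \<open>At most \<open>n\<close> of the integers from 1 to \<open>hofstadter n\<close> are among
  the first \<open>n\<close> terms, and later terms are too large to fill the gaps, so at least
  \<open>hofstadter n - n\<close> integers are omitted for good.\<close>

lemma hofstadter_excess_le_card:
  assumes fin: "finite ({1..} - hofstadter ` {1..})" and "n \<ge> 1"
  shows "hofstadter_excess n \<le> int (card ({1..} - hofstadter ` {1..}))"
proof -
  have mono: "hofstadter i < hofstadter j" if "i \<ge> 1" "i < j" for i j
    using strict_mono_onD[OF hofstadter_strict_mono, of i j] that by simp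
  have "{1..hofstadter n} - hofstadter ` {1..n} \<subseteq> {1..} - hofstadter ` {1..}"
  proof
    fix m
    assume m: "m \<in> {1..hofstadter n} - hofstadter ` {1..n}"
    then have "m \<noteq> hofstadter i" if "i \<ge> 1" for i
      using that mono[OF \<open>n \<ge> 1\<close>, of i] by (cases "i \<le> n") auto
    with m show "m \<in> {1..} - hofstadter ` {1..}"
      by auto
  qed
  then have "card ({1..hofstadter n} - hofstadter ` {1..n}) \<le> card ({1..} - hofstadter ` {1..})"
    by (rule card_mono[OF fin])
  moreover have "card {1..hofstadter n} - card (hofstadter ` {1..n})
      \<le> card ({1..hofstadter n} - hofstadter ` {1..n})"
    by (rule diff_card_le_card_Diff) simp
  moreover have "card (hofstadter ` {1..n}) \<le> n"
    using card_image_le[of "{1..n}" hofstadter] by simp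
  ultimately show ?thesis
    by (simp add: hofstadter_excess_def)
qed

theorem theorem1p3:
  shows "mono_on {1..} hofstadter_excess
    \<and> \<not> bdd_above (hofstadter_excess ` {1..})
    \<and> filterlim hofstadter_excess at_top sequentially
    \<and> infinite ({1..} - hofstadter ` {1..})"
proof (intro conjI)
  show "infinite ({1..} - hofstadter ` {1..})"
  proof
    assume "finite ({1..} - hofstadter ` {1..})"
    from hofstadter_excess_le_card[OF this] have "bdd_above (hofstadter_excess ` {1..})"
      by (intro bdd_aboveI2) simp
    then show False
      using hofstadter_excess_unbounded by contradiction
  qed
qed (fact mono_on_hofstadter_excess hofstadter_excess_unbounded filterlim_hofstadter_excess)+

end
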